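(* Let $x\in(0,1)$ be fixed. Then: (1) For every $q>0$, $p\mapsto \arcsin_{p,q}(x)$ is completely monotonic and log-convex on $(0,\infty)$. (2) For every $q>0$, $p\mapsto \arcsin_{p,q}(x)$ is strictly geometrically convex on $(0,\infty)$. (3) For every $p>0$, $q\mapsto \arcsin_{p,q}(x)$ is completely monotonic and log-convex on $(0,\infty)$. (4) For every $q>0$, $p\mapsto \operatorname{arcsinh}_{p,q}(x)$ is strictly increasing on $(0,\infty)$ and concave on $(\log\sqrt{2},\infty)$. (5) $q\mapsto \operatorname{arcsinh}_{p,q}(x)$ is strictly increasing on $(0,\infty)$ for every $p>0$, and strictly concave on $(0,\infty)$ for every $p>1$. In particular, for all $x\in(0,1)$, $$\arcsin_{p,q}^2(x)<\arcsin_{p-1,q}(x)\arcsin_{p+1,q}(x)\qquad (p>1,\ q>0),$$ $$\operatorname{arcsinh}_{p,q}^2(x)>\operatorname{arcsinh}_{p-1,q}(x)\operatorname{arcsinh}_{p+1,q}(x)\qquad (p>\log\sqrt{2}+1,\ q>0).$$ Moreover, for all $x\in(0,1)$, $$\arcsin_{p,q}^2(x)<\arcsin_{p,q-1}(x)\arcsin_{p,q+1}(x)\qquad (p>0,\ q>1),$$ $$\operatorname{arcsinh}_{p,q}^2(x)>\operatorname{arcsinh}_{p,q-1}(x)\operatorname{arcsinh}_{p,q+1}(x)\qquad (p>1,\ q>1).$$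
   Context: For $p,q>0$ and $x\in(0,1)$ define $$\arcsin_{p,q}(x)=\int_0^x(1-t^q)^{-1/p}\,dt,\qquad \operatorname{arcsinh}_{p,q}(x)=\int_0^x(1+t^q)^{-1/p}\,dt.$$ The notation $\arcsin_{p,q}^2(x)$ means $(\arcsin_{p,q}(x))^2$, and similarly for $\operatorname{arcsinh}_{p,q}$; $\log$ is the natural logarithm. A function $h:(0,\infty)\to\mathbb{R}$ is completely monotonic if it has derivatives of all orders and $(-1)^m h^{(m)}(y)\ge 0$ for all $y>0$ and $m\in\{0,1,2,\dots\}$. A function $f:(0,\infty)\to(0,\infty)$ is log-convex if $\ln f$ is convex. A function $g:(0,\infty)\to(0,\infty)$ is geometrically convex if $g(u^{\lambda}v^{1-\lambda})\le g(u)^{\lambda}g(v)^{1-\lambda}$ for all $u,v>0$ and $\lambda\in[0,1]$; it is strictly geometrically convex if the inequality is strict whenever $u\ne v$ and $\lambda\in(0,1)$. *)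

theory Defs
  imports "HOL-Analysis.Analysis"
begin

text \<open>
  The generalized inverse sine and inverse hyperbolic sine are only used for
  \<open>p, q > 0\<close> and \<open>x \<in> (0,1)\<close>. The integrands are continuous on \<open>[0,x]\<close> then, and
  their bases are positive there, so the integrals and the real powers have their
  usual meaning. At \<open>t = 0\<close> we have \<open>0 powr q = 0\<close>.
\<close>

definition arcsin_pq :: "real \<Rightarrow> real \<Rightarrow> real \<Rightarrow> real" where
  "arcsin_pq p q x = integral {0..x} (\<lambda>t. (1 - t powr q) powr (- 1 / p))"

definition arcsinh_pq :: "real \<Rightarrow> real \<Rightarrow> real \<Rightarrow> real" where
  "arcsinh_pq p q x = integral {0..x} (\<lambda>t. (1 + t powr q) powr (- 1 / p))"

text \<open>
  The notions below concern functions on \<open>(0,\<infinity>)\<close>, represented by total functions on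
  the reals whose values outside \<open>(0,\<infinity>)\<close> are irrelevant. As \<open>(0,\<infinity>)\<close> is open, all
  iterated derivatives at its points depend only on the values of the function in it.
\<close>

definition completely_monotonic :: "(real \<Rightarrow> real) \<Rightarrow> bool" where
  "completely_monotonic h \<longleftrightarrow>
     (\<forall>m. \<forall>y>0. (deriv ^^ m) h field_differentiable at y \<and>
                 (- 1) ^ m * (deriv ^^ m) h y \<ge> 0)"

text \<open>
  The codomain \<open>(0,\<infinity>)\<close> of log-convex and geometrically convex functions is
  made an explicit condition.
\<close>

definition log_convex :: "(real \<Rightarrow> real) \<Rightarrow> bool" where
  "log_convex f \<longleftrightarrow> (\<forall>y>0. f y > 0) \<and> convex_on {0<..} (\<lambda>y. ln (f y))"

definition geometrically_convex :: "(real \<Rightarrow> real) \<Rightarrow> bool" where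
  "geometrically_convex g \<longleftrightarrow>
     (\<forall>y>0. g y > 0) \<and>
     (\<forall>u>0. \<forall>v>0. \<forall>l\<in>{0..1}.
        g (u powr l * v powr (1 - l)) \<le> g u powr l * g v powr (1 - l))"

definition strictly_geometrically_convex :: "(real \<Rightarrow> real) \<Rightarrow> bool" where
  "strictly_geometrically_convex g \<longleftrightarrow>
     geometrically_convex g \<and>
     (\<forall>u>0. \<forall>v>0. \<forall>l\<in>{0<..<1}. u \<noteq> v \<longrightarrow>
        g (u powr l * v powr (1 - l)) < g u powr l * g v powr (1 - l))"

definition strictly_concave_on :: "real set \<Rightarrow> (real \<Rightarrow> real) \<Rightarrow> bool" where
  "strictly_concave_on S f \<longleftrightarrow>
     convex S \<and>
     (\<forall>u\<in>S. \<forall>v\<in>S. \<forall>l\<in>{0<..<1}. u \<noteq> v \<longrightarrow>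
        f (l * u + (1 - l) * v) > l * f u + (1 - l) * f v)"

end

(* For fixed t in (0,1) the integrands are elementary functions of the parameter, and every
   convexity property of the integrals comes from the corresponding pointwise one: concavity by
   linearity, log-convexity and geometric convexity by Hoelder's inequality. For complete
   monotonicity we exhibit sets of nonnegative integrands that, up to nonnegative linear
   combinations, are closed under minus the derivative in the parameter: writing
   L = - ln (1 - t^q), these are L^i p^(-j) exp (L / p) for the parameter p, and
   (- ln t)^j t^(k q) (1 - t^q)^(-b) for the parameter q. The inequalities for neighbouring
   parameters are strict midpoint log-convexity, respectively strict midpoint concavity and
   AM-GM. *)
theory Submission
  imports Defs "HOL-Real_Asymp.Real_Asymp"
begin

subsection \<open>Strict concavity and log-convexity\<close>

text \<open>By the mean value theorem the chord slopes on the two sides of an intermediate point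
  \<open>w\<close> are values of \<open>f'\<close> at some \<open>a < w < b\<close>, so the left
  slope is the larger one. Clearing denominators with the weights \<open>l\<close> and
  \<open>1 - l\<close> gives the inequality.\<close>

lemma strictly_concave_on_DERIV:
  assumes S: "convex S"
    and f': "\<And>y. y \<in> S \<Longrightarrow> (f has_real_derivative f' y) (at y)"
    and decr: "\<And>y z. y \<in> S \<Longrightarrow> z \<in> S \<Longrightarrow> y < z \<Longrightarrow> f' z < f' y"
  shows "strictly_concave_on S f"
proof -
  have less: "l * f u + (1 - l) * f v < f (l * u + (1 - l) * v)"
    if "u \<in> S" "v \<in> S" "u < v" "0 < l" "l < 1" for u v l
  proof -
    define w where "w = l * u + (1 - l) * v"
    have in_S: "y \<in> S" if "u \<le> y" "y \<le> v" for y
      using S[folded is_interval_convex_1] \<open>u \<in> S\<close> \<open>v \<in> S\<close> that unfolding is_interval_1 by blast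
    have uw: "w - u = (1 - l) * (v - u)" and wv: "v - w = l * (v - u)"
      by (simp_all add: w_def algebra_simps)
    then have "u < w" "w < v"
      using that by (smt (verit) mult_pos_pos)+
    obtain a where a: "u < a" "a < w" "f w - f u = (w - u) * f' a"
      using MVT2[OF \<open>u < w\<close>, of f f'] f' in_S \<open>w < v\<close> by force
    obtain b where b: "w < b" "b < v" "f v - f w = (v - w) * f' b"
      using MVT2[OF \<open>w < v\<close>, of f f'] f' in_S \<open>u < w\<close> by force
    have "f' b < f' a"
      using decr[of a b] in_S a b \<open>u < w\<close> \<open>w < v\<close> by auto
    then have "l * (1 - l) * (v - u) * f' b < l * (1 - l) * (v - u) * f' a"
      using that by (intro mult_strict_left_mono) auto
    moreover have "l * (f w - f u) = l * (1 - l) * (v - u) * f' a"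
      "(1 - l) * (f v - f w) = l * (1 - l) * (v - u) * f' b"
      by (simp_all add: a(3) b(3) uw wv)
    ultimately show ?thesis
      unfolding w_def[symmetric] by (simp add: algebra_simps)
  qed
  \<comment> \<open>The case \<open>v < u\<close> follows from \<open>less\<close> by exchanging the
    points together with their weights.\<close>
  have "l * f u + (1 - l) * f v < f (l * u + (1 - l) * v)"
    if "u \<in> S" "v \<in> S" "u \<noteq> v" "0 < l" "l < 1" for u v l
    using less[of u v l] less[of v u "1 - l"] that by (cases "u < v") (auto simp: add.commute)
  then show ?thesis
    using S by (auto simp: strictly_concave_on_def)
qed

lemma strictly_concave_on_DERIV2:
  assumes S: "convex S"
    and f': "\<And>y. y \<in> S \<Longrightarrow> (f has_real_derivative f' y) (at y)"
    and f'': "\<And>y. y \<in> S \<Longrightarrow> (f' has_real_derivative f'' y) (at y)"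
    and neg: "\<And>y. y \<in> S \<Longrightarrow> f'' y < 0"
  shows "strictly_concave_on S f"
proof (rule strictly_concave_on_DERIV[OF S f'])
  fix y z assume yz: "y \<in> S" "z \<in> S" "y < z"
  have in_S: "w \<in> S" if "y \<le> w" "w \<le> z" for w
    using S[folded is_interval_convex_1] yz that unfolding is_interval_1 by blast
  show "f' z < f' y"
    using DERIV_neg_imp_decreasing[OF \<open>y < z\<close>, of f'] f'' neg in_S by blast
qed

lemma strictly_concave_onD:
  assumes "strictly_concave_on S f" "u \<in> S" "v \<in> S" "u \<noteq> v" "0 < l" "l < 1"
  shows "l * f u + (1 - l) * f v < f (l * u + (1 - l) * v)"
  using assms by (auto simp: strictly_concave_on_def)

lemma strictly_concave_on_imp_concave_on:
  assumes "strictly_concave_on S f"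
  shows "concave_on S f"
  unfolding concave_on_def
proof (rule convex_on_linorderI)
  show "convex S" using assms by (simp add: strictly_concave_on_def)
  fix t u v :: real
  assume "0 < t" "t < 1" "u \<in> S" "v \<in> S" "u < v"
  then show "- f ((1 - t) *\<^sub>R u + t *\<^sub>R v) \<le> (1 - t) * - f u + t * - f v"
    using strictly_concave_onD[OF assms, of u v "1 - t"] by simp
qed

text \<open>At the midpoint, \<open>f y\<close> exceeds the arithmetic mean of the two outer values,
  which is at least their geometric mean. Positivity allows squaring.\<close>

lemma strictly_concave_on_geometric_mean:
  assumes f: "strictly_concave_on S f" and "y - h \<in> S" "y + h \<in> S" "h \<noteq> 0"
    and pos: "0 < f (y - h)" "0 < f (y + h)"
  shows "f (y - h) * f (y + h) < (f y)\<^sup>2"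
proof -
  have "f y > (f (y - h) + f (y + h)) / 2"
    using strictly_concave_onD[OF f, of "y - h" "y + h" "1 / 2"] assms
    by (simp add: field_simps)
  then have "((f (y - h) + f (y + h)) / 2)\<^sup>2 < (f y)\<^sup>2"
    using pos by (intro power_strict_mono) auto
  moreover have "0 \<le> (f (y - h) - f (y + h))\<^sup>2"
    by simp
  ultimately show ?thesis
    by (simp add: power2_eq_square field_simps)
qed

section \<open>Hoelder's inequality and convexity of parameter integrals\<close>

text \<open>Normalizing \<open>f\<close> and \<open>g\<close> by their integrals \<open>A\<close>
  and \<open>B\<close> and applying Young's inequality bounds \<open>h\<close> by \<open>K\<close>
  times a convex combination of \<open>f / A\<close> and \<open>g / B\<close>, which integrates to
  1. Strictness comes from the pointwise bound on \<open>h\<close>, not from Young's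
  inequality.\<close>

lemma integral_Hoelder_strict:
  fixes f g h :: "real \<Rightarrow> real"
  assumes "a < b" and l: "0 < l" "l < 1"
    and cont: "continuous_on {a..b} f" "continuous_on {a..b} g" "continuous_on {a..b} h"
    and pos: "\<And>t. t \<in> {a..b} \<Longrightarrow> 0 < f t" "\<And>t. t \<in> {a..b} \<Longrightarrow> 0 < g t"
    and less: "\<And>t. t \<in> {a<..<b} \<Longrightarrow> h t < f t powr l * g t powr (1 - l)"
  shows "integral {a..b} h < integral {a..b} f powr l * integral {a..b} g powr (1 - l)"
proof -
  define A B where "A = integral {a..b} f" and "B = integral {a..b} g"
  have "A > 0" "B > 0"
    unfolding A_def B_def
    using integral_less_real[of a b "\<lambda>_. 0"] cont pos \<open>a < b\<close> by auto
  define K where "K = A powr l * B powr (1 - l)"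
  have "K > 0" using \<open>A > 0\<close> \<open>B > 0\<close> by (simp add: K_def)
  have "integral {a..b} h < integral {a..b} (\<lambda>t. K * (l * (f t / A) + (1 - l) * (g t / B)))"
  proof (rule integral_less_real)
    fix t assume t: "t \<in> {a<..<b}"
    have "f t powr l * g t powr (1 - l) = K * ((f t / A) powr l * (g t / B) powr (1 - l))"
      using \<open>A > 0\<close> \<open>B > 0\<close> pos[of t] t by (simp add: K_def powr_divide)
    also have "\<dots> \<le> K * (l * (f t / A) + (1 - l) * (g t / B))"
      using \<open>A > 0\<close> \<open>B > 0\<close> \<open>K > 0\<close> pos[of t] t l
      by (intro mult_left_mono Youngs_inequality_0) auto
    finally show "h t < K * (l * (f t / A) + (1 - l) * (g t / B))"
      using less[OF t] by simp
  qed (use \<open>a < b\<close> cont \<open>A > 0\<close> \<open>B > 0\<close> in \<open>auto intro!: continuous_intros\<close>)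
  also have "integral {a..b} (\<lambda>t. K * (l * (f t / A) + (1 - l) * (g t / B))) =
      K * (l * (A / A) + (1 - l) * (B / B))"
    unfolding A_def B_def
    by (intro integral_unique has_integral_mult_right has_integral_add has_integral_divide
        integrable_integral integrable_continuous_real cont)
  also have "\<dots> = K"
    using \<open>A > 0\<close> \<open>B > 0\<close> by simp
  finally show ?thesis
    by (simp add: K_def A_def B_def)
qed

text \<open>The multiplicative form matches the conclusion of Hoelder's inequality. The strict
  version serves the strict inequalities between neighbouring parameters as well as
  \<open>log_convex\<close>.\<close>

definition strictly_log_convex :: "(real \<Rightarrow> real) \<Rightarrow> bool" where
  "strictly_log_convex f \<longleftrightarrow> (\<forall>y>0. 0 < f y) \<and> (\<forall>u>0. \<forall>v>0. \<forall>l\<in>{0<..<1}. u \<noteq> v \<longrightarrow>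
     f (l * u + (1 - l) * v) < f u powr l * f v powr (1 - l))"

lemma strictly_log_convex_imp_log_convex:
  assumes "strictly_log_convex f"
  shows "log_convex f"
proof -
  have pos: "0 < f y" if "0 < y" for y
    using assms that by (auto simp: strictly_log_convex_def)
  have "convex_on {0<..} (\<lambda>y. ln (f y))"
  proof (rule convex_on_linorderI)
    fix t u v :: real
    assume *: "0 < t" "t < 1" "u \<in> {0<..}" "v \<in> {0<..}" "u < v"
    define w where "w = (1 - t) * u + t * v"
    have "0 < w" using * by (auto simp: w_def intro: add_pos_pos)
    have "f w < f u powr (1 - t) * f v powr t"
      using assms[unfolded strictly_log_convex_def, THEN conjunct2, rule_format, of u v "1 - t"] *
      by (simp add: w_def)
    then have "ln (f w) \<le> ln (f u powr (1 - t) * f v powr t)"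
      using pos[OF \<open>0 < w\<close>] by (subst ln_le_cancel_iff) auto
    also have "\<dots> = (1 - t) * ln (f u) + t * ln (f v)"
      using pos[of u] pos[of v] * by (simp add: ln_mult)
    finally show "ln (f ((1 - t) *\<^sub>R u + t *\<^sub>R v)) \<le> (1 - t) * ln (f u) + t * ln (f v)"
      by (simp add: w_def)
  qed simp
  then show ?thesis using pos by (simp add: log_convex_def)
qed

lemma strictly_log_convex_geometric_mean:
  assumes f: "strictly_log_convex f" and "0 < y - h" "0 < y + h" "h \<noteq> 0"
  shows "(f y)\<^sup>2 < f (y - h) * f (y + h)"
proof -
  have pos: "0 < f (y - h)" "0 < f (y + h)" "0 < f y"
    using assms by (auto simp: strictly_log_convex_def)
  have "f y < f (y - h) powr (1/2) * f (y + h) powr (1/2)"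
    using f[unfolded strictly_log_convex_def, THEN conjunct2, rule_format, of "y - h" "y + h" "1/2"] assms
    by (simp add: field_simps)
  then have "f y < sqrt (f (y - h) * f (y + h))"
    using pos by (simp add: powr_half_sqrt real_sqrt_mult)
  then have "(f y)\<^sup>2 < (sqrt (f (y - h) * f (y + h)))\<^sup>2"
    using pos by (intro power_strict_mono) auto
  then show ?thesis using pos by simp
qed

text \<open>Exponentiating the pointwise convexity of \<open>ln (F y t)\<close> gives the hypothesis
  of the strict Hoelder inequality. It is phrased as concavity of the negative so that the
  derivative criteria apply, and only for interior \<open>t\<close>: the arcsine integrands do not
  depend on the parameter at \<open>t = 0\<close>.\<close>

lemma strictly_log_convex_integral:
  fixes F :: "real \<Rightarrow> real \<Rightarrow> real"
  assumes "a < b"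
    and cont: "\<And>y. 0 < y \<Longrightarrow> continuous_on {a..b} (F y)"
    and pos: "\<And>y t. 0 < y \<Longrightarrow> t \<in> {a..b} \<Longrightarrow> 0 < F y t"
    and conv: "\<And>t. t \<in> {a<..<b} \<Longrightarrow> strictly_concave_on {0<..} (\<lambda>y. - ln (F y t))"
  shows "strictly_log_convex (\<lambda>y. integral {a..b} (F y))"
  unfolding strictly_log_convex_def
proof (intro conjI allI impI ballI)
  show "0 < integral {a..b} (F y)" if "0 < y" for y
    using integral_less_real[of a b "\<lambda>_. 0" "F y"] cont pos \<open>a < b\<close> that by auto
  fix u v l :: real
  assume uv: "0 < u" "0 < v" "l \<in> {0<..<1}" "u \<noteq> v"
  then have w: "0 < l * u + (1 - l) * v" by (auto intro: add_pos_pos)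
  show "integral {a..b} (F (l * u + (1 - l) * v)) <
      integral {a..b} (F u) powr l * integral {a..b} (F v) powr (1 - l)"
  proof (rule integral_Hoelder_strict)
    fix t assume t: "t \<in> {a<..<b}"
    have p: "0 < F u t" "0 < F v t" "0 < F (l * u + (1 - l) * v) t"
      using pos uv w t by auto
    have "ln (F (l * u + (1 - l) * v) t) < l * ln (F u t) + (1 - l) * ln (F v t)"
      using strictly_concave_onD[OF conv[OF t], of u v l] uv by simp
    also have "\<dots> = ln (F u t powr l * F v t powr (1 - l))"
      using p by (simp add: ln_mult)
    finally show "F (l * u + (1 - l) * v) t < F u t powr l * F v t powr (1 - l)"
      using p by (subst (asm) ln_less_cancel_iff) auto
  qed (use uv w assms in auto)
qed

lemma strictly_concave_on_integral:
  fixes F :: "real \<Rightarrow> real \<Rightarrow> real"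
  assumes "a < b" and "convex S"
    and cont: "\<And>y. y \<in> S \<Longrightarrow> continuous_on {a..b} (F y)"
    and conc: "\<And>t. t \<in> {a<..<b} \<Longrightarrow> strictly_concave_on S (\<lambda>y. F y t)"
  shows "strictly_concave_on S (\<lambda>y. integral {a..b} (F y))"
  unfolding strictly_concave_on_def
proof (intro conjI ballI impI)
  fix u v l :: real
  assume uv: "u \<in> S" "v \<in> S" "l \<in> {0<..<1}" "u \<noteq> v"
  then have w: "l * u + (1 - l) * v \<in> S"
    using \<open>convex S\<close> by (auto simp: convex_def)
  have "l * integral {a..b} (F u) + (1 - l) * integral {a..b} (F v) =
      integral {a..b} (\<lambda>t. l * F u t + (1 - l) * F v t)"
    using uv by (subst integral_add) (auto intro!: integrable_continuous_real continuous_intros cont)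
  also have "\<dots> < integral {a..b} (F (l * u + (1 - l) * v))"
    using \<open>a < b\<close> uv w strictly_concave_onD[OF conc uv(1,2,4), of _ l]
    by (intro integral_less_real continuous_intros cont) auto
  finally show "integral {a..b} (F (l * u + (1 - l) * v)) >
      l * integral {a..b} (F u) + (1 - l) * integral {a..b} (F v)" .
qed (fact \<open>convex S\<close>)

subsection \<open>Completely monotonic integrals\<close>

text \<open>Members are integrands \<open>F y t\<close> with parameter \<open>y\<close> and
  integration variable \<open>t\<close>. Passing to the cone matters because the derivative of one
  generator is in general a combination of several.\<close>

inductive_set conic_span :: "('a \<Rightarrow> 'b \<Rightarrow> real) set \<Rightarrow> ('a \<Rightarrow> 'b \<Rightarrow> real) set"
  for B :: "('a \<Rightarrow> 'b \<Rightarrow> real) set" where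
  base: "F \<in> B \<Longrightarrow> F \<in> conic_span B"
| add: "F \<in> conic_span B \<Longrightarrow> G \<in> conic_span B \<Longrightarrow> (\<lambda>y t. F y t + G y t) \<in> conic_span B"
| scale: "F \<in> conic_span B \<Longrightarrow> 0 \<le> c \<Longrightarrow> (\<lambda>y t. c * F y t) \<in> conic_span B"

text \<open>Continuity, nonnegativity and closure under minus the derivative extend from
  \<open>B\<close> to its cone. Differentiating under the integral sign then shows inductively that
  the derivative of order \<open>m\<close> is \<open>(- 1) ^ m\<close> times the integral of a
  nonnegative member of the cone.\<close>

lemma completely_monotonic_integral:
  fixes B :: "(real \<Rightarrow> real \<Rightarrow> real) set"
  assumes cont: "\<And>F. F \<in> B \<Longrightarrow> continuous_on ({0<..} \<times> {a..b}) (\<lambda>(y, t). F y t)"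
    and nonneg: "\<And>F y t. F \<in> B \<Longrightarrow> 0 < y \<Longrightarrow> t \<in> {a..b} \<Longrightarrow> 0 \<le> F y t"
    and deriv: "\<And>F. F \<in> B \<Longrightarrow> \<exists>G\<in>conic_span B. \<forall>y>0. \<forall>t\<in>{a..b}.
      ((\<lambda>y. F y t) has_real_derivative - G y t) (at y)"
    and "F \<in> conic_span B"
  shows "completely_monotonic (\<lambda>y. integral {a..b} (F y))"
proof -
  have cont': "continuous_on ({0<..} \<times> {a..b}) (\<lambda>(y, t). F y t)" if "F \<in> conic_span B" for F
    using that by induction (auto intro: continuous_intros cont[unfolded split_beta] simp: split_beta)
  have nonneg': "0 \<le> F y t" if "F \<in> conic_span B" "0 < y" "t \<in> {a..b}" for F y t
    using that by induction (auto intro: nonneg)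
  have deriv': "\<exists>G\<in>conic_span B. \<forall>y>0. \<forall>t\<in>{a..b}. ((\<lambda>y. F y t) has_real_derivative - G y t) (at y)"
    if "F \<in> conic_span B" for F
    using that
  proof induction
    case (add F1 F2)
    then obtain G1 G2 where "G1 \<in> conic_span B" "G2 \<in> conic_span B"
      "\<forall>y>0. \<forall>t\<in>{a..b}. ((\<lambda>y. F1 y t) has_real_derivative - G1 y t) (at y)"
      "\<forall>y>0. \<forall>t\<in>{a..b}. ((\<lambda>y. F2 y t) has_real_derivative - G2 y t) (at y)"
      by blast
    then show ?case
      by (intro bexI[of _ "\<lambda>y t. G1 y t + G2 y t"] conic_span.add)
        (auto intro!: derivative_eq_intros)
  next
    case (scale F c)
    then obtain G where "G \<in> conic_span B"
      "\<forall>y>0. \<forall>t\<in>{a..b}. ((\<lambda>y. F y t) has_real_derivative - G y t) (at y)"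
      by blast
    with \<open>0 \<le> c\<close> show ?case
      by (intro bexI[of _ "\<lambda>y t. c * G y t"] conic_span.scale)
        (auto intro!: derivative_eq_intros)
  qed (rule deriv)
  have integral_deriv: "\<exists>G\<in>conic_span B. \<forall>y>0.
      ((\<lambda>y. integral {a..b} (F y)) has_real_derivative - integral {a..b} (G y)) (at y)"
    if F: "F \<in> conic_span B" for F
  proof -
    obtain G where G: "G \<in> conic_span B"
      "\<forall>y>0. \<forall>t\<in>{a..b}. ((\<lambda>y. F y t) has_real_derivative - G y t) (at y)"
      using deriv'[OF F] by blast
    have "((\<lambda>y. integral {a..b} (F y)) has_real_derivative - integral {a..b} (G y)) (at y)"
      if "0 < y" for y
    proof -
      \<comment> \<open>Leibniz' rule, with joint continuity of \<open>G\<close> as the condition on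
        the derivative; on the open ray the derivative within the set is the full one.\<close>
      have "((\<lambda>y. integral (cbox a b) (F y)) has_field_derivative
          integral (cbox a b) (\<lambda>t. - G y t)) (at y within {0<..})"
      proof (rule leibniz_rule_field_derivative)
        show "F z integrable_on cbox a b" if "z \<in> {0<..}" for z
        proof -
          have "continuous_on {a..b} (\<lambda>t. case (z, t) of (y, t) \<Rightarrow> F y t)"
            by (rule continuous_on_compose2[OF cont'[OF F]], intro continuous_intros)
              (use that in auto)
          then show ?thesis
            using integrable_continuous_real by simp
        qed
        show "continuous_on ({0<..} \<times> cbox a b) (\<lambda>(y, t). - G y t)"
          using continuous_on_minus[OF cont'[OF G(1)]] by (simp add: split_beta)
      qed (use G(2) that in \<open>auto intro: has_field_derivative_at_within\<close>)
      then show ?thesis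
        using that by (simp add: at_within_open[of y "{0<..}"])
    qed
    with G(1) show ?thesis by blast
  qed
  have step: "\<exists>H\<in>conic_span B. \<forall>y>0.
      ((deriv ^^ m) h has_real_derivative (- 1) ^ Suc m * integral {a..b} (H y)) (at y)"
    if G: "G \<in> conic_span B" "\<forall>y>0. (deriv ^^ m) h y = (- 1) ^ m * integral {a..b} (G y)" for G h m
  proof -
    obtain H where H: "H \<in> conic_span B"
      "\<forall>y>0. ((\<lambda>y. integral {a..b} (G y)) has_real_derivative - integral {a..b} (H y)) (at y)"
      using integral_deriv[OF G(1)] by blast
    \<comment> \<open>The integral formula for \<open>(deriv ^^ m) h\<close> is known only on the
      open ray, which suffices to transfer the derivative there.\<close>
    have "((deriv ^^ m) h has_real_derivative (- 1) ^ m * - integral {a..b} (H y)) (at y)"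
      if "0 < y" for y
      by (rule has_field_derivative_transform_within_open[where S = "{0<..}",
            OF DERIV_cmult[OF H(2)[rule_format, OF that]]])
        (use G(2) that in auto)
    with H(1) show ?thesis by auto
  qed
  have iterate: "\<exists>G\<in>conic_span B. \<forall>y>0.
      (deriv ^^ m) (\<lambda>y. integral {a..b} (F y)) y = (- 1) ^ m * integral {a..b} (G y)" for m
  proof (induction m)
    case 0
    then show ?case using \<open>F \<in> conic_span B\<close> by auto
  next
    case (Suc m)
    then obtain H where "H \<in> conic_span B" "\<forall>y>0. ((deriv ^^ m) (\<lambda>y. integral {a..b} (F y))
        has_real_derivative (- 1) ^ Suc m * integral {a..b} (H y)) (at y)"
      using step by blast
    then show ?case
      by (intro bexI[of _ H]) (auto dest: DERIV_imp_deriv)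
  qed
  show ?thesis
    unfolding completely_monotonic_def
  proof (intro allI impI conjI)
    fix m and y :: real
    assume "0 < y"
    obtain G where G: "G \<in> conic_span B"
      "\<forall>y>0. (deriv ^^ m) (\<lambda>y. integral {a..b} (F y)) y = (- 1) ^ m * integral {a..b} (G y)"
      using iterate by blast
    show "(deriv ^^ m) (\<lambda>y. integral {a..b} (F y)) field_differentiable at y"
      using step[OF G] \<open>0 < y\<close> by (auto simp: field_differentiable_def)
    have "(- 1) ^ m * (deriv ^^ m) (\<lambda>y. integral {a..b} (F y)) y = integral {a..b} (G y)"
      using G(2) \<open>0 < y\<close> by (simp flip: mult.assoc power_mult_distrib)
    \<comment> \<open>The integral of a non-integrable function is 0 by convention, so the sign of
      the integrand is enough.\<close>
    also have "\<dots> \<ge> 0"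
      using nonneg'[OF G(1) \<open>0 < y\<close>]
      by (cases "G y integrable_on {a..b}") (auto intro!: integral_nonneg simp: not_integrable_integral)
    finally show "(- 1) ^ m * (deriv ^^ m) (\<lambda>y. integral {a..b} (F y)) y \<ge> 0" .
  qed
qed

text \<open>A factor \<open>u\<close> beats every power of the logarithm at 0, so the limit there
  agrees with the value 0. With \<open>u = t powr q\<close> this controls logarithmic integrands up
  to \<open>t = 0\<close>.\<close>

lemma continuous_on_times_ln_power:
  "continuous_on {0..<1} (\<lambda>u::real. (- ln u) ^ j * u)"
proof -
  have "isCont (\<lambda>u::real. (- ln u) ^ j * u) u" if "0 < u" for u
    using that by (intro continuous_intros) auto
  then have "continuous (at u within {0..<1}) (\<lambda>u. (- ln u) ^ j * u)" if "0 < u" for u :: real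
    using that by (blast intro: continuous_at_imp_continuous_at_within)
  moreover have "((\<lambda>u::real. (- ln u) ^ j * u) \<longlongrightarrow> 0) (at_right 0)"
    by real_asymp
  then have "((\<lambda>u::real. (- ln u) ^ j * u) \<longlongrightarrow> 0) (at 0 within {0..<1})"
    by (rule tendsto_mono[rotated]) (auto simp: at_within_def intro: le_infI2)
  then have "continuous (at 0 within {0..<1}) (\<lambda>u::real. (- ln u) ^ j * u)"
    by (simp add: continuous_within)
  ultimately show ?thesis
    unfolding continuous_on_eq_continuous_within
    by (auto simp: order_le_less)
qed

subsection \<open>The generalized inverse sines\<close>

lemma powr_less_one_of_less_one: "0 \<le> t \<Longrightarrow> t < 1 \<Longrightarrow> 0 < q \<Longrightarrow> t powr q < (1::real)"
  by (rule less_le_trans[OF powr_less_mono2]) auto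

lemma powr_strict_antimono_of_less_one:
  fixes t :: real
  assumes "0 < t" "t < 1" "u < v"
  shows "t powr v < t powr u"
  using assms by (simp add: powr_def mult_strict_right_mono_neg)

text \<open>This isolates \<open>p\<close> in an exponential of a multiple of \<open>1 / p\<close>,
  the form behind complete monotonicity and geometric convexity in \<open>p\<close>.\<close>

lemma arcsin_pq_integrand_eq:
  fixes t p q :: real
  assumes "0 \<le> t" "t < 1" "0 < q"
  shows "(1 - t powr q) powr (- 1 / p) = exp (- ln (1 - t powr q) / p)"
  using powr_less_one_of_less_one[OF assms] by (simp add: powr_def[of "1 - t powr q"])

lemma continuous_on_arcsin_pq_integrand:
  fixes x p q :: real
  assumes "x < 1" "0 < q"
  shows "continuous_on {0..x} (\<lambda>t. (1 - t powr q) powr (- 1 / p))"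
proof -
  have "t powr q \<noteq> 1" if "t \<in> {0..x}" for t
    using powr_less_one_of_less_one[of t q] assms that by force
  moreover have "continuous_on {0..x} (\<lambda>t. t powr q)"
    using assms by (intro continuous_on_powr' continuous_intros) auto
  then have "continuous_on {0..x} (\<lambda>t. 1 - t powr q)"
    by (intro continuous_on_diff continuous_on_const)
  ultimately show ?thesis
    by (intro continuous_on_powr[where f = "\<lambda>t. 1 - t powr q"]) auto
qed

lemma continuous_on_arcsinh_pq_integrand:
  fixes x p q :: real
  assumes "0 < q"
  shows "continuous_on {0..x} (\<lambda>t. (1 + t powr q) powr (- 1 / p))"
proof -
  have "1 + t powr q \<noteq> 0" for t
    by (simp add: add_nonneg_eq_0_iff)
  moreover have "continuous_on {0..x} (\<lambda>t. t powr q)"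
    using assms by (intro continuous_on_powr' continuous_intros) auto
  then have "continuous_on {0..x} (\<lambda>t. 1 + t powr q)"
    by (intro continuous_on_add continuous_on_const)
  ultimately show ?thesis
    by (intro continuous_on_powr[where f = "\<lambda>t. 1 + t powr q"]) auto
qed

section \<open>Complete monotonicity of the generalized inverse sine\<close>

text \<open>The integrand is \<open>T 0 0\<close>, and all \<open>T i j\<close> are nonnegative
  because \<open>L\<close> is.\<close>

lemma completely_monotonic_arcsin_pq_p:
  assumes "x < 1" "0 < q"
  shows "completely_monotonic (\<lambda>p. arcsin_pq p q x)"
proof -
  define L where "L t = - ln (1 - t powr q)" for t :: real
  define T where "T i j p t = L t ^ i * inverse p ^ j * exp (L t / p)" for i j :: nat and p t :: real
  define B where "B = range (\<lambda>(i, j). T i j)"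
  have base: "T i j \<in> conic_span B" for i j
    by (intro conic_span.base) (auto simp: B_def)
  have powr_less: "t powr q < 1" if "t \<in> {0..x}" for t
    using powr_less_one_of_less_one that assms by auto
  have L_nonneg: "0 \<le> L t" if "t \<in> {0..x}" for t
    using powr_less[OF that] by (simp add: L_def)
  have "continuous_on {0..x} (\<lambda>t. t powr q)"
    using assms by (intro continuous_on_powr' continuous_intros) auto
  then have "continuous_on {0..x} L"
    unfolding L_def using powr_less by (intro continuous_on_minus continuous_on_ln continuous_on_diff continuous_on_const) force+
  then have L_cont: "continuous_on ({0<..} \<times> {0..x}) (\<lambda>z. L (snd z))"
    by (rule continuous_on_compose2) (auto intro: continuous_intros)
  have "completely_monotonic (\<lambda>p. integral {0..x} (T 0 0 p))"
  proof (rule completely_monotonic_integral[where B = B])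
    fix F assume "F \<in> B"
    then obtain i j where F: "F = T i j" by (auto simp: B_def)
    show "continuous_on ({0<..} \<times> {0..x}) (\<lambda>(p, t). F p t)"
      unfolding F T_def split_beta by (intro continuous_intros L_cont) auto
    show "0 \<le> F p t" if "0 < p" "t \<in> {0..x}" for p t
      using L_nonneg that by (simp add: F T_def)
    show "\<exists>G\<in>conic_span B. \<forall>p>0. \<forall>t\<in>{0..x}. ((\<lambda>p. F p t) has_real_derivative - G p t) (at p)"
    proof (intro bexI allI impI ballI)
      \<comment> \<open>The product rule gives the two summands: differentiating
        \<open>inverse p ^ j\<close> raises \<open>j\<close> by one, and differentiating
        \<open>exp (L t / p)\<close> brings out \<open>- L t / p^2\<close>.\<close>
      show "(\<lambda>p t. real j * T i (Suc j) p t + T (Suc i) (Suc (Suc j)) p t) \<in> conic_span B"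
        by (intro conic_span.add conic_span.scale base) auto
      show "((\<lambda>p. F p t) has_real_derivative
          - (real j * T i (Suc j) p t + T (Suc i) (Suc (Suc j)) p t)) (at p)" if "0 < p" for p t
        unfolding F T_def using that
        by (auto intro!: derivative_eq_intros; cases j; simp add: field_simps)
    qed
  qed (rule base)
  moreover have "arcsin_pq p q x = integral {0..x} (T 0 0 p)" for p
    unfolding arcsin_pq_def using assms
    by (intro integral_cong) (simp add: arcsin_pq_integrand_eq[simplified] T_def L_def)
  ultimately show ?thesis by simp
qed

text \<open>The integrand is \<open>T 0 0 (1 / p)\<close>. Since \<open>t powr q\<close> has
  derivative \<open>t powr q * ln t\<close> in \<open>q\<close>, each differentiation brings out one
  factor \<open>ln t\<close>, and its sign makes minus the derivative nonnegative.\<close>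

lemma completely_monotonic_arcsin_pq_q:
  assumes "x < 1" "0 < p"
  shows "completely_monotonic (\<lambda>q. arcsin_pq p q x)"
proof -
  define T where "T j k b q t = (- ln t) ^ j * (t powr q) ^ k * (1 - t powr q) powr - b"
    for j k :: nat and b q t :: real
  \<comment> \<open>For \<open>k = 0 < j\<close> the term is unbounded near \<open>t = 0\<close>; such terms never arise, because every
    derivative that introduces a factor \<open>- ln t\<close> also leaves a positive power of \<open>t powr q\<close>.\<close>
  define B where "B = {T j k b |j k b. 0 < b \<and> (k = 0 \<longrightarrow> j = 0)}"
  have base: "T j k b \<in> conic_span B" if "0 < b" "k = 0 \<longrightarrow> j = 0" for j k b
    using that by (intro conic_span.base) (auto simp: B_def)
  have powr_less: "t powr q < 1" if "0 < q" "t \<in> {0..x}" for q t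
    using powr_less_one_of_less_one that assms by auto
  have powr_cont: "continuous_on ({0<..} \<times> {0..x}) (\<lambda>z. snd z powr fst z :: real)"
    by (intro continuous_on_powr' continuous_intros) auto
  have "completely_monotonic (\<lambda>q. integral {0..x} (T 0 0 (1 / p) q))"
  proof (rule completely_monotonic_integral[where B = B])
    fix F assume "F \<in> B"
    then obtain j k b where F: "F = T j k b" "0 < b" "k = 0 \<longrightarrow> j = 0"
      by (auto simp: B_def)
    show "continuous_on ({0<..} \<times> {0..x}) (\<lambda>(q, t). F q t)"
    proof -
      have c: "continuous_on ({0<..} \<times> {0..x}) (\<lambda>z. (1 - snd z powr fst z) powr - b)"
      proof (rule continuous_on_powr)
        show "continuous_on ({0<..} \<times> {0..x}) (\<lambda>z. 1 - snd z powr fst z)"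
          by (intro continuous_on_diff continuous_on_const powr_cont)
        show "\<forall>z\<in>{0<..} \<times> {0..x}. 1 - snd z powr fst z \<noteq> 0"
          by (auto dest!: powr_less)
      qed (rule continuous_on_const)
      show ?thesis
      proof (cases k)
        case 0
        with F c show ?thesis by (simp add: T_def split_beta)
      next
        case (Suc k')
        \<comment> \<open>In terms of \<open>u = t powr q\<close>, \<open>- ln t = - ln u / q\<close> separates the variables.\<close>
        have ln_powr_cont: "continuous_on ({0<..} \<times> {0..x})
            (\<lambda>z. (- ln (snd z powr fst z)) ^ j * (snd z powr fst z))"
          by (rule continuous_on_compose2[OF continuous_on_times_ln_power powr_cont])
            (auto simp: powr_less)
        have "continuous_on ({0<..} \<times> {0..x}) (\<lambda>z. inverse (fst z :: real) ^ j)"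
          by (intro continuous_on_power continuous_on_inverse continuous_on_fst continuous_on_id) auto
        then have "continuous_on ({0<..} \<times> {0..x}) (\<lambda>z. inverse (fst z) ^ j *
            ((- ln (snd z powr fst z)) ^ j * (snd z powr fst z)) *
            (snd z powr fst z) ^ k' * (1 - snd z powr fst z) powr - b)"
          by (rule continuous_on_mult[OF continuous_on_mult[OF continuous_on_mult[OF _ ln_powr_cont]
                continuous_on_power[OF powr_cont]] c])
        moreover have "F q t = inverse q ^ j * ((- ln (t powr q)) ^ j * (t powr q)) *
            (t powr q) ^ k' * (1 - t powr q) powr - b" if "0 < q" for q t
        proof -
          have "inverse q ^ j * (- ln (t powr q)) ^ j = (- ln t) ^ j" if "t \<noteq> 0"
          proof -
            have "inverse q * - ln (t powr q) = - ln t"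
              using \<open>0 < q\<close> that by (simp add: ln_powr)
            then show ?thesis by (metis power_mult_distrib)
          qed
          \<comment> \<open>At \<open>t = 0\<close> both sides vanish through a factor
            \<open>t powr q\<close>, present because \<open>k\<close> is a successor.\<close>
          then show ?thesis
            by (cases "t = 0") (auto simp: F T_def Suc)
        qed
        ultimately show ?thesis
          by - (rule continuous_on_eq, assumption, auto simp: split_beta)
      qed
    qed
    show "0 \<le> F q t" if "0 < q" "t \<in> {0..x}" for q t
    proof -
      \<comment> \<open>At \<open>t = 0\<close> this is the convention
        \<open>ln 0 = 0\<close>.\<close>
      have "ln t \<le> 0"
        using that assms by (cases "t = 0") auto
      then show ?thesis by (simp add: F T_def)
    qed
    show "\<exists>G\<in>conic_span B. \<forall>q>0. \<forall>t\<in>{0..x}. ((\<lambda>q. F q t) has_real_derivative - G q t) (at q)"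
    proof -
      define G where "G q t = real k * T (Suc j) k b q t + b * T (Suc j) (Suc k) (b + 1) q t" for q t
      have "(\<lambda>q t. b * T (Suc j) (Suc k) (b + 1) q t) \<in> conic_span B"
        using F by (intro conic_span.scale base) auto
      then have "G \<in> conic_span B"
        unfolding G_def using F
        by (cases "k = 0") (auto intro!: conic_span.add conic_span.scale base)
      moreover have "((\<lambda>q. F q t) has_real_derivative - G q t) (at q)"
        if "0 < q" "t \<in> {0..x}" for q t
      proof (cases "t = 0")
        case True
        \<comment> \<open>As \<open>0 powr q = 0\<close> for every \<open>q\<close>, the integrand
          is constant in \<open>q\<close> here, and each summand of \<open>G\<close> has a zero
          factor.\<close>
        have "- G q t = 0" using F by (simp add: G_def T_def True)
        moreover have "(\<lambda>q. F q t) = (\<lambda>q. F 1 t)" by (simp add: F T_def True)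
        ultimately show ?thesis by (metis DERIV_const)
      next
        case False
        have D: "((\<lambda>q. t powr q) has_real_derivative t powr q * ln t) (at q)"
          using False that by (auto intro!: derivative_eq_intros)
        have "((\<lambda>q. (t powr q) ^ k) has_real_derivative real k * (t powr q) ^ k * ln t) (at q)"
          by (rule DERIV_cong[OF DERIV_power[OF D]]) (cases k; simp)
        moreover have "((\<lambda>q. (1 - t powr q) powr - b) has_real_derivative
            b * (t powr q * ln t) * (1 - t powr q) powr - (b + 1)) (at q)"
          by (rule DERIV_cong[OF DERIV_fun_powr[OF DERIV_diff[OF DERIV_const D]]])
            (use powr_less[OF that] in auto)
        ultimately have "((\<lambda>q. (- ln t) ^ j * ((t powr q) ^ k * (1 - t powr q) powr - b))
            has_real_derivative - G q t) (at q)"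
          by (rule DERIV_cong[OF DERIV_cmult[OF DERIV_mult]])
            (simp add: G_def T_def algebra_simps)
        then have "((\<lambda>q. (- ln t) ^ j * (t powr q) ^ k * (1 - t powr q) powr - b)
            has_real_derivative - G q t) (at q)"
          by (simp only: mult.assoc)
        then show ?thesis by (simp add: F T_def)
      qed
      ultimately show ?thesis by blast
    qed
  qed (use assms in \<open>auto intro: base\<close>)
  then show ?thesis
    by (simp add: arcsin_pq_def T_def[abs_def])
qed

section \<open>Log-convexity and geometric convexity of the generalized inverse sine\<close>

text \<open>The logarithm of the integrand is a positive multiple of \<open>1 / p\<close> when
  \<open>0 < t\<close>, hence strictly convex in \<open>p\<close>.\<close>

lemma strictly_log_convex_arcsin_pq_p:
  assumes "0 < x" "x < 1" "0 < q"
  shows "strictly_log_convex (\<lambda>p. arcsin_pq p q x)"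
  unfolding arcsin_pq_def
proof (rule strictly_log_convex_integral)
  fix t assume t: "t \<in> {0<..<x}"
  then have tq: "0 < t powr q" "t powr q < 1"
    using powr_less_one_of_less_one assms by auto
  show "strictly_concave_on {0<..} (\<lambda>p. - ln ((1 - t powr q) powr (- 1 / p)))"
  proof (rule strictly_concave_on_DERIV)
    show "((\<lambda>p. - ln ((1 - t powr q) powr (- 1 / p))) has_real_derivative
        - ln (1 - t powr q) / p\<^sup>2) (at p)" if "p \<in> {0<..}" for p
      using tq that by (auto intro!: derivative_eq_intros simp: ln_powr power2_eq_square)
    show "- ln (1 - t powr q) / v\<^sup>2 < - ln (1 - t powr q) / u\<^sup>2"
      if "u \<in> {0<..}" "v \<in> {0<..}" "u < v" for u v
      using tq that by (intro divide_strict_left_mono power_strict_mono mult_pos_pos) auto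
  qed simp
qed (use assms continuous_on_arcsin_pq_integrand powr_less_one_of_less_one in force)+

lemma strictly_log_convex_arcsin_pq_q:
  assumes "0 < x" "x < 1" "0 < p"
  shows "strictly_log_convex (\<lambda>q. arcsin_pq p q x)"
  unfolding arcsin_pq_def
proof (rule strictly_log_convex_integral)
  fix t assume t: "t \<in> {0<..<x}"
  have tq: "0 < t powr q" "t powr q < 1" if "0 < q" for q
    using powr_less_one_of_less_one t assms that by auto
  show "strictly_concave_on {0<..} (\<lambda>q. - ln ((1 - t powr q) powr (- 1 / p)))"
  proof (rule strictly_concave_on_DERIV)
    \<comment> \<open>Writing \<open>u / (1 - u)\<close> as \<open>1 / (1 - u) - 1\<close> with
      \<open>u = t powr q\<close> leaves a single occurrence of \<open>u\<close>, so the decrease in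
      \<open>q\<close> can be read off.\<close>
    show "((\<lambda>q. - ln ((1 - t powr q) powr (- 1 / p))) has_real_derivative
        - ln t / p * (1 / (1 - t powr q) - 1)) (at q)" if "q \<in> {0<..}" for q
    proof (rule has_field_derivative_transform_within_open[where S = "{0<..}"])
      show "((\<lambda>q. ln (1 - t powr q) / p) has_real_derivative
          - ln t / p * (1 / (1 - t powr q) - 1)) (at q)"
        using tq[of q] t that \<open>0 < p\<close> by (auto intro!: derivative_eq_intros simp: field_simps)
    qed (use that tq in \<open>auto simp: ln_powr\<close>)
    show "- ln t / p * (1 / (1 - t powr v) - 1) < - ln t / p * (1 / (1 - t powr u) - 1)"
      if "u \<in> {0<..}" "v \<in> {0<..}" "u < v" for u v
      using tq[of u] tq[of v] t assms that
      by (intro mult_strict_left_mono diff_strict_right_mono divide_strict_left_mono mult_pos_pos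
          divide_neg_pos powr_strict_antimono_of_less_one diff_strict_left_mono) (auto simp: divide_neg_pos)
  qed simp
qed (use assms continuous_on_arcsin_pq_integrand powr_less_one_of_less_one in force)+

text \<open>This is strict concavity of \<open>ln\<close>, exponentiated.\<close>

lemma weighted_AM_GM_strict:
  fixes a b l :: real
  assumes "0 < a" "0 < b" "a \<noteq> b" "0 < l" "l < 1"
  shows "a powr l * b powr (1 - l) < l * a + (1 - l) * b"
proof -
  have "strictly_concave_on {0<..} (\<lambda>y::real. ln y)"
    by (rule strictly_concave_on_DERIV[where f' = "\<lambda>y. 1 / y"])
      (auto intro!: derivative_eq_intros divide_strict_left_mono)
  then have "l * ln a + (1 - l) * ln b < ln (l * a + (1 - l) * b)"
    using assms by (intro strictly_concave_onD) auto
  then have "ln (a powr l * b powr (1 - l)) < ln (l * a + (1 - l) * b)"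
    using assms by (simp add: ln_mult)
  then show ?thesis
    using assms by (subst (asm) ln_less_cancel_iff) (auto intro: add_pos_pos)
qed

text \<open>The integrand is \<open>exp (c / p)\<close> with \<open>c > 0\<close> for
  \<open>0 < t\<close>. Strict AM-GM for \<open>1 / u\<close> and \<open>1 / v\<close> gives the
  pointwise inequality, and Hoelder's inequality integrates it.\<close>

lemma strictly_geometrically_convex_arcsin_pq_p:
  assumes "0 < x" "x < 1" "0 < q"
  shows "strictly_geometrically_convex (\<lambda>p. arcsin_pq p q x)"
proof -
  have pos: "0 < arcsin_pq p q x" if "0 < p" for p
    using strictly_log_convex_arcsin_pq_p[OF assms] that by (auto simp: strictly_log_convex_def)
  have less: "arcsin_pq (u powr l * v powr (1 - l)) q x <
      arcsin_pq u q x powr l * arcsin_pq v q x powr (1 - l)"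
    if uv: "0 < u" "0 < v" "u \<noteq> v" "0 < l" "l < 1" for u v l
    unfolding arcsin_pq_def
  proof (rule integral_Hoelder_strict)
    fix t assume t: "t \<in> {0<..<x}"
    define c where "c = - ln (1 - t powr q)"
    have tq: "0 < t powr q" "t powr q < 1"
      using powr_less_one_of_less_one t assms by auto
    then have "0 < c" by (simp add: c_def)
    have eq: "(1 - t powr q) powr (- 1 / p) = exp (c / p)" for p
      using arcsin_pq_integrand_eq[of t q p] t assms by (simp add: c_def)
    have "(1 / u) powr l * (1 / v) powr (1 - l) < l * (1 / u) + (1 - l) * (1 / v)"
      using uv by (intro weighted_AM_GM_strict) auto
    then have "c / (u powr l * v powr (1 - l)) < c * (l * (1 / u) + (1 - l) * (1 / v))"
      using mult_strict_left_mono[OF _ \<open>0 < c\<close>] uv by (fastforce simp: powr_divide)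
    also have "\<dots> = c / u * l + c / v * (1 - l)"
      by (simp add: algebra_simps)
    finally show "(1 - t powr q) powr (- 1 / (u powr l * v powr (1 - l))) <
        ((1 - t powr q) powr (- 1 / u)) powr l * ((1 - t powr q) powr (- 1 / v)) powr (1 - l)"
      unfolding eq by (simp add: exp_powr_real flip: exp_add)
  qed (use assms that continuous_on_arcsin_pq_integrand powr_less_one_of_less_one in force)+
  have "arcsin_pq (u powr l * v powr (1 - l)) q x \<le>
      arcsin_pq u q x powr l * arcsin_pq v q x powr (1 - l)"
    if "0 < u" "0 < v" "l \<in> {0..1}" for u v l
  proof -
    \<comment> \<open>The first three cases are equalities; positivity is needed there because
      \<open>0 powr 0\<close> is 0.\<close>
    consider "l = 0" | "l = 1" | "u = v" | "u \<noteq> v" "0 < l" "l < 1"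
      using \<open>l \<in> {0..1}\<close> by force
    then show ?thesis
      using that less[of u v l] pos[of u] pos[of v]
      by cases (auto simp flip: powr_add)
  qed
  then show ?thesis
    using less pos by (auto simp: strictly_geometrically_convex_def geometrically_convex_def)
qed

section \<open>Monotonicity and concavity of the generalized inverse hyperbolic sine\<close>

lemma arcsinh_pq_pos:
  assumes "0 < x" "0 < q"
  shows "0 < arcsinh_pq p q x"
  unfolding arcsinh_pq_def
  using integral_less_real[of 0 x "\<lambda>_. 0"] continuous_on_arcsinh_pq_integrand assms
  by (auto simp: add_nonneg_eq_0_iff)

lemma strict_mono_on_arcsinh_pq_p:
  assumes "0 < x" "0 < q"
  shows "strict_mono_on {0<..} (\<lambda>p. arcsinh_pq p q x)"
proof (rule strict_mono_onI)
  fix u v :: real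
  assume "u \<in> {0<..}" "v \<in> {0<..}" "u < v"
  then show "arcsinh_pq u q x < arcsinh_pq v q x"
    unfolding arcsinh_pq_def using assms
    by (intro integral_less_real continuous_on_arcsinh_pq_integrand powr_less_mono)
      (auto simp: field_simps)
qed

text \<open>For \<open>0 < t < 1\<close> the base \<open>1 + t powr q\<close> decreases in
  \<open>q\<close>, and the negative exponent reverses this.\<close>

lemma strict_mono_on_arcsinh_pq_q:
  assumes "0 < x" "x < 1" "0 < p"
  shows "strict_mono_on {0<..} (\<lambda>q. arcsinh_pq p q x)"
proof (rule strict_mono_onI)
  fix u v :: real
  assume "u \<in> {0<..}" "v \<in> {0<..}" "u < v"
  then show "arcsinh_pq p u x < arcsinh_pq p v x"
    unfolding arcsinh_pq_def using assms
    by (intro integral_less_real continuous_on_arcsinh_pq_integrand powr_less_mono2_neg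
        add_strict_left_mono powr_strict_antimono_of_less_one) (auto intro: add_pos_nonneg)
qed

text \<open>The second derivative of \<open>exp (- M / p)\<close> has the sign of
  \<open>M - 2 * p\<close>. As \<open>M = ln (1 + t powr q)\<close> stays below
  \<open>ln 2 = 2 * ln (sqrt 2)\<close>, the threshold \<open>ln (sqrt 2)\<close> makes it negative
  for all \<open>t\<close> at once.\<close>

lemma strictly_concave_on_arcsinh_pq_p:
  assumes "0 < x" "x < 1" "0 < q"
  shows "strictly_concave_on {ln (sqrt 2)<..} (\<lambda>p. arcsinh_pq p q x)"
  unfolding arcsinh_pq_def
proof (rule strictly_concave_on_integral)
  fix t assume t: "t \<in> {0<..<x}"
  define M where "M = ln (1 + t powr q)"
  have tq: "0 < t powr q" "t powr q < 1"
    using powr_less_one_of_less_one t assms by auto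
  then have "1 < 1 + t powr q" "1 + t powr q < 2" "0 < 1 + t powr q"
    by linarith+
  then have "0 < M" "M < ln 2"
    by (simp_all add: M_def)
  moreover have ln2: "ln 2 = 2 * ln (sqrt 2)" by (simp add: ln_sqrt)
  moreover have "0 < ln (sqrt 2)" by simp
  ultimately have p: "0 < p \<and> M < 2 * p" if "p \<in> {ln (sqrt 2)<..}" for p
    using that by force
  have eq: "(1 + t powr q) powr (- 1 / p) = exp (- M / p)" for p
    using tq by (simp add: powr_def M_def)
  show "strictly_concave_on {ln (sqrt 2)<..} (\<lambda>p. (1 + t powr q) powr (- 1 / p))"
    unfolding eq
  proof (rule strictly_concave_on_DERIV2)
    fix y assume "y \<in> {ln (sqrt 2)<..}"
    note y = p[OF this]
    show "((\<lambda>p. exp (- M / p)) has_real_derivative M / y\<^sup>2 * exp (- M / y)) (at y)"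
      using y by (auto intro!: derivative_eq_intros simp: power2_eq_square)
    show "((\<lambda>y. M / y\<^sup>2 * exp (- M / y)) has_real_derivative
        M * (M - 2 * y) / y ^ 4 * exp (- M / y)) (at y)"
      using y by (auto intro!: derivative_eq_intros simp: field_simps power_numeral_reduce)
    show "M * (M - 2 * y) / y ^ 4 * exp (- M / y) < 0"
      using y \<open>0 < M\<close> by (intro mult_neg_pos divide_neg_pos mult_pos_neg) auto
  qed simp
qed (use assms continuous_on_arcsinh_pq_integrand in force)+

text \<open>The second derivative of the integrand has the sign of \<open>a * t powr q - 1\<close>
  with \<open>a = 1 / p\<close>; it is negative because \<open>p > 1\<close> gives
  \<open>a < 1\<close>.\<close>

lemma strictly_concave_on_arcsinh_pq_q:
  assumes "0 < x" "x < 1" "1 < p"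
  shows "strictly_concave_on {0<..} (\<lambda>q. arcsinh_pq p q x)"
  unfolding arcsinh_pq_def
proof (rule strictly_concave_on_integral)
  fix t assume t: "t \<in> {0<..<x}"
  define a where "a = 1 / p"
  have a: "0 < a" "a < 1" using assms by (simp_all add: a_def)
  show "strictly_concave_on {0<..} (\<lambda>q. (1 + t powr q) powr (- 1 / p))"
  proof (rule strictly_concave_on_DERIV2)
    fix q :: real assume "q \<in> {0<..}"
    then have tq: "0 < t powr q" "t powr q < 1"
      using powr_less_one_of_less_one t assms by auto
    then have pos: "0 < 1 + t powr q" by linarith
    show "((\<lambda>q. (1 + t powr q) powr (- 1 / p)) has_real_derivative
        - a * ln t * t powr q * (1 + t powr q) powr (- a - 1)) (at q)"
      using tq t by (auto intro!: derivative_eq_intros simp: pos a_def)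
    show "((\<lambda>q. - a * ln t * t powr q * (1 + t powr q) powr (- a - 1)) has_real_derivative
        a * (ln t)\<^sup>2 * t powr q * (1 + t powr q) powr (- a - 2) * (a * t powr q - 1)) (at q)"
    proof -
      \<comment> \<open>Splitting off one factor gives both terms of the product rule the common
        power \<open>- a - 2\<close>.\<close>
      have *: "(1 + t powr q) powr (- a - 1) = (1 + t powr q) powr (- a - 2) * (1 + t powr q)"
      proof -
        have "- a - 1 = (- a - 2) + 1" by simp
        then show ?thesis using pos by (simp only: powr_add powr_one)
      qed
      show ?thesis
        using tq t by (auto intro!: derivative_eq_intros simp: pos * power2_eq_square algebra_simps)
    qed
    have "a * t powr q < 1"
      using a tq mult_strict_mono[of a 1 "t powr q" 1] by simp
    then show "a * (ln t)\<^sup>2 * t powr q * (1 + t powr q) powr (- a - 2) * (a * t powr q - 1) < 0"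
      using a tq t assms pos by (intro mult_pos_neg mult_pos_pos) auto
  qed simp
qed (use assms continuous_on_arcsinh_pq_integrand in force)+

theorem theorem2:
  fixes x :: real
  assumes "0 < x" and "x < 1"
  shows "(\<forall>q>0. completely_monotonic (\<lambda>p. arcsin_pq p q x) \<and> log_convex (\<lambda>p. arcsin_pq p q x)) \<and>
    (\<forall>q>0. strictly_geometrically_convex (\<lambda>p. arcsin_pq p q x)) \<and>
    (\<forall>p>0. completely_monotonic (\<lambda>q. arcsin_pq p q x) \<and> log_convex (\<lambda>q. arcsin_pq p q x)) \<and>
    (\<forall>q>0. strict_mono_on {0<..} (\<lambda>p. arcsinh_pq p q x) \<and>
           concave_on {ln (sqrt 2)<..} (\<lambda>p. arcsinh_pq p q x)) \<and>
    ((\<forall>p>0. strict_mono_on {0<..} (\<lambda>q. arcsinh_pq p q x)) \<and>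
     (\<forall>p>1. strictly_concave_on {0<..} (\<lambda>q. arcsinh_pq p q x))) \<and>
    (\<forall>p>1. \<forall>q>0. (arcsin_pq p q x)\<^sup>2 < arcsin_pq (p - 1) q x * arcsin_pq (p + 1) q x) \<and>
    (\<forall>p>ln (sqrt 2) + 1. \<forall>q>0.
        (arcsinh_pq p q x)\<^sup>2 > arcsinh_pq (p - 1) q x * arcsinh_pq (p + 1) q x) \<and>
    (\<forall>p>0. \<forall>q>1. (arcsin_pq p q x)\<^sup>2 < arcsin_pq p (q - 1) x * arcsin_pq p (q + 1) x) \<and>
    (\<forall>p>1. \<forall>q>1. (arcsinh_pq p q x)\<^sup>2 > arcsinh_pq p (q - 1) x * arcsinh_pq p (q + 1) x)"
proof (intro conjI allI impI)
  show "completely_monotonic (\<lambda>p. arcsin_pq p q x)" if "0 < q" for q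
    using completely_monotonic_arcsin_pq_p assms that by blast
  show "log_convex (\<lambda>p. arcsin_pq p q x)" if "0 < q" for q
    using strictly_log_convex_arcsin_pq_p strictly_log_convex_imp_log_convex assms that by blast
  show "strictly_geometrically_convex (\<lambda>p. arcsin_pq p q x)" if "0 < q" for q
    using strictly_geometrically_convex_arcsin_pq_p assms that by blast
  show "completely_monotonic (\<lambda>q. arcsin_pq p q x)" if "0 < p" for p
    using completely_monotonic_arcsin_pq_q assms that by blast
  show "log_convex (\<lambda>q. arcsin_pq p q x)" if "0 < p" for p
    using strictly_log_convex_arcsin_pq_q strictly_log_convex_imp_log_convex assms that by blast
  show "strict_mono_on {0<..} (\<lambda>p. arcsinh_pq p q x)" if "0 < q" for q
    using strict_mono_on_arcsinh_pq_p assms that by blast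
  show "concave_on {ln (sqrt 2)<..} (\<lambda>p. arcsinh_pq p q x)" if "0 < q" for q
    using strictly_concave_on_arcsinh_pq_p strictly_concave_on_imp_concave_on assms that by blast
  show "strict_mono_on {0<..} (\<lambda>q. arcsinh_pq p q x)" if "0 < p" for p
    using strict_mono_on_arcsinh_pq_q assms that by blast
  show "strictly_concave_on {0<..} (\<lambda>q. arcsinh_pq p q x)" if "1 < p" for p
    using strictly_concave_on_arcsinh_pq_q assms that by blast
  show "(arcsin_pq p q x)\<^sup>2 < arcsin_pq (p - 1) q x * arcsin_pq (p + 1) q x"
    if "1 < p" "0 < q" for p q
    using strictly_log_convex_geometric_mean[OF strictly_log_convex_arcsin_pq_p, of x q p 1]
      assms that by simp
  show "(arcsin_pq p q x)\<^sup>2 < arcsin_pq p (q - 1) x * arcsin_pq p (q + 1) x"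
    if "0 < p" "1 < q" for p q
    using strictly_log_convex_geometric_mean[OF strictly_log_convex_arcsin_pq_q, of x p q 1]
      assms that by simp
  \<comment> \<open>The bound on \<open>p\<close> keeps \<open>p - 1\<close> inside the interval of
    concavity.\<close>
  show "arcsinh_pq (p - 1) q x * arcsinh_pq (p + 1) q x < (arcsinh_pq p q x)\<^sup>2"
    if "ln (sqrt 2) + 1 < p" "0 < q" for p q
    using strictly_concave_on_geometric_mean[OF strictly_concave_on_arcsinh_pq_p, of x q p 1]
      arcsinh_pq_pos assms that by simp
  show "arcsinh_pq p (q - 1) x * arcsinh_pq p (q + 1) x < (arcsinh_pq p q x)\<^sup>2"
    if "1 < p" "1 < q" for p q
    using strictly_concave_on_geometric_mean[OF strictly_concave_on_arcsinh_pq_q, of x p q 1]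
      arcsinh_pq_pos assms that by simp
qed

end
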